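(* For all integers $n\ge 2$, $$\mathrm{ospt}(n)\le\frac{p(n)-M(0,n)}{2}.$$ Moreover, $M(0,n)$ is positive for $n\ge 3$.
   Context: $p(n)$ is the number of partitions of $n$. For a partition $\lambda=(\lambda_1\ge\dots\ge\lambda_\ell)$, $\mathrm{rank}(\lambda)=\lambda_1-\ell$; letting $o(\lambda)$ be the number of parts equal to $1$ and $\mu(\lambda)$ the number of parts strictly larger than $o(\lambda)$, for $|\lambda|>1$ one sets $\mathrm{crank}(\lambda)=\lambda_1$ if $o(\lambda)=0$ and $\mathrm{crank}(\lambda)=\mu(\lambda)-o(\lambda)$ if $o(\lambda)>0$. $M(m,n)$ is the number of partitions of $n$ with crank $m$. $\mathrm{ospt}(n):=\sum_{|\lambda|=n,\ \mathrm{crank}(\lambda)>0}\mathrm{crank}(\lambda)-\sum_{|\lambda|=n,\ \mathrm{rank}(\lambda)>0}\mathrm{rank}(\lambda)$. *)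

theory Defs
  imports Complex_Main "HOL-Library.Multiset"
begin

text \<open>
  A partition is the multiset of its parts, so \<open>Max_mset\<close> is the largest part and \<open>size\<close>
  is the number of parts, counted with multiplicity.
\<close>

definition partitions :: "nat \<Rightarrow> nat multiset set" where
  "partitions n = {L. 0 \<notin># L \<and> sum_mset L = n}"

lemma finite_partitions [simp]: "finite (partitions n)"
proof (rule finite_subset)
  show "partitions n \<subseteq> mset ` {xs. set xs \<subseteq> {..n} \<and> length xs \<le> n}"
  proof
    fix L assume L: "L \<in> partitions n"
    obtain xs where xs: "L = mset xs" by (metis ex_mset)
    have pos: "0 \<notin> set xs" and sum: "sum_list xs = n"
      using L by (auto simp: partitions_def xs sum_mset_sum_list)
    have "length xs \<le> sum_list xs"
      using pos by (induction xs) auto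
    moreover have "set xs \<subseteq> {..n}"
      using member_le_sum_list[of _ xs] sum by auto
    ultimately show "L \<in> mset ` {xs. set xs \<subseteq> {..n} \<and> length xs \<le> n}"
      using xs sum by auto
  qed
  show "finite (mset ` {xs. set xs \<subseteq> {..n} \<and> length xs \<le> n})"
    by (intro finite_imageI finite_lists_length_le) simp
qed

definition num_partitions :: "nat \<Rightarrow> nat" where
  "num_partitions n = card (partitions n)"

text \<open>Rank and crank are meant for nonempty partitions; the crank only for those of \<open>n > 1\<close>.\<close>

definition rank :: "nat multiset \<Rightarrow> int" where
  "rank L = int (Max_mset L) - int (size L)"

definition num_ones :: "nat multiset \<Rightarrow> nat" where
  "num_ones L = count L 1"

definition num_above_ones :: "nat multiset \<Rightarrow> nat" where
  "num_above_ones L = size {#x \<in># L. x > num_ones L#}"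

definition crank :: "nat multiset \<Rightarrow> int" where
  "crank L =
     (if num_ones L = 0 then int (Max_mset L)
      else int (num_above_ones L) - int (num_ones L))"

definition crank_count :: "int \<Rightarrow> nat \<Rightarrow> nat" where
  "crank_count m n = card {L \<in> partitions n. crank L = m}"

definition ospt :: "nat \<Rightarrow> int" where
  "ospt n = (\<Sum>L | L \<in> partitions n \<and> crank L > 0. crank L)
          - (\<Sum>L | L \<in> partitions n \<and> rank L > 0. rank L)"

end

theory Submission
  imports Defs
begin

text \<open>
  Write \<open>p\<close> for the partition function, \<open>C m\<close> and \<open>A m\<close> for the numbers of partitions of \<open>n\<close>
  with crank, respectively rank, at least \<open>m\<close>.  Then \<open>ospt n\<close> is the sum over \<open>m \<ge> 1\<close> of
  \<open>C m - A m\<close>, and \<open>(p n - M(0, n)) / 2 = C 1\<close> by the symmetry of the crank, so the claim is that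
  the sum of \<open>C m\<close> over \<open>m \<ge> 2\<close> is at most the sum of \<open>A m\<close> over \<open>m \<ge> 1\<close>.

  Recursions for \<open>C\<close> (from counting partitions whose diagram contains a given rectangle) and
  for \<open>A\<close> (Dyson's map) express both as alternating sums of values \<open>p (n - (s + \<dots> + (s + k - 1)))\<close>,
  that is, of the numbers of partitions of \<open>n\<close> containing all of \<open>s, \<dots>, s + k - 1\<close> as parts.
  After cancellation the difference of the two sums is \<open>- T 2 + T 3 - T 4 + \<dots>\<close>, where \<open>T s\<close> counts
  the partitions in which the maximal run of consecutive parts \<open>s, s + 1, \<dots>\<close> has length at least
  \<open>s\<close> and of the same parity as \<open>s\<close>.  An injection shows that \<open>T\<close> is decreasing.
\<close>

subsection \<open>Counting partitions\<close>

lemma partitionsD: "L \<in> partitions n \<Longrightarrow> 0 \<notin># L" "L \<in> partitions n \<Longrightarrow> sum_mset L = n"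
  by (auto simp: partitions_def)

text \<open>The argument is an integer so that recursions may shift it below \<open>0\<close>, where the count vanishes.\<close>

definition pcount :: "(nat multiset \<Rightarrow> bool) \<Rightarrow> int \<Rightarrow> int" where
  "pcount Q k = (if k < 0 then 0 else int (card {L \<in> partitions (nat k). Q L}))"

lemma pcount_int: "pcount Q (int n) = int (card {L \<in> partitions n. Q L})"
  by (simp add: pcount_def)

lemma pcount_neg: "k < 0 \<Longrightarrow> pcount Q k = 0"
  by (simp add: pcount_def)

lemma pcount_nonneg: "0 \<le> pcount Q k"
  by (simp add: pcount_def)

lemma pcount_eq_sum:
  "pcount Q (int n) = (\<Sum>L\<in>partitions n. of_bool (Q L))"
  by (simp add: pcount_int sum_of_bool_eq Collect_conj_eq)

lemma pcount_cong:
  assumes "\<And>L. L \<in> partitions (nat k) \<Longrightarrow> 0 \<le> k \<Longrightarrow> Q L = R L"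
  shows "pcount Q k = pcount R k"
proof (cases "k < 0")
  case False
  then have "{L \<in> partitions (nat k). Q L} = {L \<in> partitions (nat k). R L}"
    using assms by auto
  then show ?thesis by (simp add: pcount_def)
qed (simp add: pcount_def)

lemma pcount_eq_0:
  assumes "\<And>L. L \<in> partitions (nat k) \<Longrightarrow> 0 \<le> k \<Longrightarrow> \<not> Q L"
  shows "pcount Q k = 0"
proof -
  have "pcount Q k = pcount (\<lambda>_. False) k" using assms by (intro pcount_cong) auto
  then show ?thesis by (simp add: pcount_def)
qed

lemma pcount_split: "pcount Q k = pcount (\<lambda>L. Q L \<and> R L) k + pcount (\<lambda>L. Q L \<and> \<not> R L) k"
proof (cases "k < 0")
  case False
  have "{L \<in> partitions (nat k). Q L} =
      {L \<in> partitions (nat k). Q L \<and> R L} \<union> {L \<in> partitions (nat k). Q L \<and> \<not> R L}" by auto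
  then have "card {L \<in> partitions (nat k). Q L} =
      card {L \<in> partitions (nat k). Q L \<and> R L} + card {L \<in> partitions (nat k). Q L \<and> \<not> R L}"
    by (simp add: card_Un_disjoint disjoint_iff)
  then show ?thesis using False by (simp add: pcount_def)
qed (simp add: pcount_def)

lemma pcount_diff:
  assumes "\<And>L. R L \<Longrightarrow> Q L"
  shows "pcount Q k - pcount R k = pcount (\<lambda>L. Q L \<and> \<not> R L) k"
proof -
  have "pcount (\<lambda>L. Q L \<and> R L) k = pcount R k" using assms by (intro pcount_cong) auto
  then show ?thesis using pcount_split[of Q k R] by simp
qed

lemma pcount_fibres:
  fixes f :: "nat multiset \<Rightarrow> nat"
  assumes "\<And>L. L \<in> partitions n \<Longrightarrow> f L < K"
  shows "pcount Q (int n) = (\<Sum>j<K. pcount (\<lambda>L. f L = j \<and> Q L) (int n))"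
proof -
  have "{L \<in> partitions n. Q L} = (\<Union>j<K. {L \<in> partitions n. f L = j \<and> Q L})"
    using assms by auto
  also have "card \<dots> = (\<Sum>j<K. card {L \<in> partitions n. f L = j \<and> Q L})"
    by (rule card_UN_disjoint) auto
  finally show ?thesis by (simp add: pcount_int)
qed

text \<open>Adding the parts of \<open>A\<close> is a bijection from the partitions of
  \<open>k - sum_mset A\<close> with \<open>Q\<close> to those of \<open>k\<close> with
  \<open>R\<close>; if \<open>k\<close> is too small, both counts vanish. In generating functions
  this is multiplication by a power of q.\<close>

lemma pcount_shift:
  assumes "0 \<notin># A"
    and "\<And>L. 0 \<notin># L \<Longrightarrow> R (L + A) = Q L"
    and "\<And>L. 0 \<notin># L \<Longrightarrow> R L \<Longrightarrow> A \<subseteq># L"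
  shows "pcount R k = pcount Q (k - int (sum_mset A))"
proof (cases "k < int (sum_mset A)")
  case True
  have "pcount R k = 0"
  proof (rule pcount_eq_0, rule notI)
    fix L assume L: "L \<in> partitions (nat k)" "0 \<le> k" "R L"
    then have "A \<subseteq># L" using assms(3) by (auto simp: partitions_def)
    then have "sum_mset L = sum_mset A + sum_mset (L - A)"
      by (metis subset_mset.add_diff_inverse sum_mset.union)
    then have "int (sum_mset A) \<le> k" using partitionsD(2)[OF L(1)] L(2) by linarith
    then show False using True by linarith
  qed
  then show ?thesis using True by (simp add: pcount_neg)
next
  case False
  define N where "N = nat k - sum_mset A"
  have k: "nat k = N + sum_mset A" and kN: "nat (k - int (sum_mset A)) = N"
    using False unfolding N_def by linarith+
  have "bij_betw (\<lambda>L. L + A) {L \<in> partitions N. Q L} {L \<in> partitions (nat k). R L}"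
    unfolding k
  proof (rule bij_betw_byWitness[where f' = "\<lambda>L. L - A"])
    show "\<forall>L\<in>{L \<in> partitions (N + sum_mset A). R L}. L - A + A = L"
      using assms(3) by (auto simp: partitions_def)
    show "(\<lambda>L. L - A) ` {L \<in> partitions (N + sum_mset A). R L} \<subseteq> {L \<in> partitions N. Q L}"
    proof (intro image_subsetI)
      fix L assume L: "L \<in> {L \<in> partitions (N + sum_mset A). R L}"
      then have sub: "A \<subseteq># L" using assms(3) by (auto simp: partitions_def)
      have 0: "0 \<notin># L - A" using L by (auto simp: partitions_def dest: in_diffD)
      then have "Q (L - A)" using assms(2)[OF 0] sub L by simp
      moreover have "sum_mset (L - A) = N"
        using L sub by (auto simp: partitions_def sum_mset_diff)
      ultimately show "L - A \<in> {L \<in> partitions N. Q L}" using 0 by (simp add: partitions_def)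
    qed
  qed (use assms(1,2) in \<open>auto simp: partitions_def\<close>)
  note card = bij_betw_same_card[OF this]
  have "\<not> k < 0" "\<not> k - int (sum_mset A) < 0" using False by linarith+
  then show ?thesis by (simp only: pcount_def kN card if_False)
qed

text \<open>This is the height of column \<open>b\<close> of the Ferrers diagram for
  \<open>b\<close> at least 1, so \<open>a \<le> parts_ge b L\<close> says that the diagram contains
  a rectangle with \<open>a\<close> rows and \<open>b\<close> columns.\<close>

abbreviation parts_ge :: "nat \<Rightarrow> nat multiset \<Rightarrow> nat" where
  "parts_ge b L \<equiv> size {#x \<in># L. b \<le> x#}"

lemma parts_ge_Suc: "parts_ge b L = parts_ge (Suc b) L + count L b"
  by (induction L) auto

lemma parts_ge_antimono: "b \<le> c \<Longrightarrow> parts_ge c L \<le> parts_ge b L"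
  by (induction L) auto

lemma parts_ge_mult_le: "b * parts_ge b L \<le> sum_mset L"
  by (induction L) auto

lemma parts_ge_le: "L \<in> partitions n \<Longrightarrow> 1 \<le> b \<Longrightarrow> parts_ge b L \<le> n"
  using parts_ge_mult_le[of b L] partitionsD(2)[of L n]
  by (metis le_trans mult.commute mult_le_mono2 mult.right_neutral)

lemma member_le_partition: "L \<in> partitions n \<Longrightarrow> x \<in># L \<Longrightarrow> x \<le> n"
  by (auto simp: partitions_def sum_mset.remove)

lemma size_le_partition: "L \<in> partitions n \<Longrightarrow> size L \<le> n"
proof -
  have "0 \<notin># L \<Longrightarrow> size L \<le> sum_mset L" by (induction L) auto
  then show "L \<in> partitions n \<Longrightarrow> size L \<le> n" by (auto simp: partitions_def)
qed

subsection \<open>Partitions containing a rectangle\<close>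

definition rect_count :: "nat \<Rightarrow> nat \<Rightarrow> int \<Rightarrow> int" where
  "rect_count a b = pcount (\<lambda>L. a \<le> parts_ge b L)"

abbreviation npart :: "int \<Rightarrow> int" where
  "npart \<equiv> pcount (\<lambda>_. True)"

lemma rect_count_0: "rect_count 0 b = npart"
  by (simp add: rect_count_def)

lemma rect_count_eq_0:
  assumes "1 \<le> b" "k < int a"
  shows "rect_count a b k = 0"
  unfolding rect_count_def
proof (rule pcount_eq_0)
  fix L assume "L \<in> partitions (nat k)" "0 \<le> k"
  then show "\<not> a \<le> parts_ge b L" using parts_ge_le[of L "nat k" b] assms by auto
qed

text \<open>Remove the part \<open>b\<close> in row \<open>a + 1\<close>.\<close>

lemma rect_count_rec:
  assumes "1 \<le> b"
  shows "rect_count (Suc a) b k - rect_count (Suc a) (Suc b) k =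
    rect_count a b (k - int b) - rect_count (Suc a) (Suc b) (k - int b)"
proof -
  have "rect_count (Suc a) b k - rect_count (Suc a) (Suc b) k =
      pcount (\<lambda>L. Suc a \<le> parts_ge b L \<and> \<not> Suc a \<le> parts_ge (Suc b) L) k"
    unfolding rect_count_def by (rule pcount_diff) (use parts_ge_Suc[of b] in auto)
  also have "\<dots> = pcount (\<lambda>L. a \<le> parts_ge b L \<and> \<not> Suc a \<le> parts_ge (Suc b) L)
      (k - int (sum_mset {#b#}))"
  proof (rule pcount_shift)
    fix L assume "Suc a \<le> parts_ge b L \<and> \<not> Suc a \<le> parts_ge (Suc b) L"
    then have "0 < count L b" using parts_ge_Suc[of b L] by linarith
    then show "{#b#} \<subseteq># L" by simp
  qed (use assms in auto)
  also have "\<dots> = rect_count a b (k - int b) - rect_count (Suc a) (Suc b) (k - int b)"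
    unfolding rect_count_def
  proof (subst pcount_diff)
    fix L assume "Suc a \<le> parts_ge (Suc b) L"
    also have "\<dots> \<le> parts_ge b L" by (rule parts_ge_antimono) simp
    finally show "a \<le> parts_ge b L" by linarith
  qed simp
  finally show ?thesis .
qed

section \<open>Conjugate partitions\<close>

definition conjugate :: "nat multiset \<Rightarrow> nat multiset" where
  "conjugate L = {#y \<in># image_mset (\<lambda>j. parts_ge (Suc j) L) (mset_set {..<sum_mset L}). y \<noteq> 0#}"

text \<open>The cells of the diagram are counted by columns. Any bound on the parts reaches every
  column, so the range up to \<open>sum_mset L\<close> in \<open>conjugate\<close> misses
  none.\<close>

lemma sum_parts_ge:
  assumes "\<And>x. x \<in># L \<Longrightarrow> x \<le> n"
  shows "(\<Sum>j<n. parts_ge (Suc j) L) = sum_mset L"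
  using assms
proof (induction L)
  case (add x L)
  have "(\<Sum>j<n. of_bool (Suc j \<le> x)) = card {j. j < n \<and> Suc j \<le> x}"
    by (simp add: of_bool_def sum.If_cases Int_def)
  also have "{j. j < n \<and> Suc j \<le> x} = {..<x}" using add.prems[of x] by auto
  finally have "(\<Sum>j<n. of_bool (Suc j \<le> x)) = x" by simp
  moreover have "parts_ge (Suc j) (add_mset x L) = of_bool (Suc j \<le> x) + parts_ge (Suc j) L" for j
    by simp
  ultimately show ?case using add by (simp add: sum.distrib)
qed simp

lemma sum_mset_filter_neq_0: "sum_mset {#y \<in># M. y \<noteq> (0::nat)#} = sum_mset M"
  by (induction M) auto

lemma conjugate_in_partitions:
  assumes "L \<in> partitions n"
  shows "conjugate L \<in> partitions n"
proof -
  have "sum_mset (conjugate L) = (\<Sum>j<n. parts_ge (Suc j) L)"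
    using assms unfolding conjugate_def sum_mset_filter_neq_0
    by (simp add: partitions_def sum_unfold_sum_mset)
  also have "\<dots> = n"
    using assms sum_parts_ge[of L n] member_le_partition[OF assms] by (simp add: partitions_def)
  finally show ?thesis by (simp add: partitions_def conjugate_def)
qed

lemma less_card_down_closed:
  fixes S :: "nat set"
  assumes "finite S" "\<And>i j. j \<in> S \<Longrightarrow> i \<le> j \<Longrightarrow> i \<in> S"
  shows "k < card S \<longleftrightarrow> k \<in> S"
proof
  assume "k \<in> S"
  then have "{..k} \<subseteq> S" using assms by auto
  then have "card {..k} \<le> card S" using assms(1) card_mono by blast
  then show "k < card S" by simp
next
  assume k: "k < card S"
  show "k \<in> S"
  proof (rule ccontr)
    assume "k \<notin> S"
    then have "S \<subseteq> {..<k}" using assms(2) by (meson lessThan_iff not_le subsetI)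
    then have "card S \<le> card {..<k}" using card_mono by blast
    then show False using k by simp
  qed
qed

text \<open>Cell by cell, the diagram is reflected: row and column indices change places. The column
  heights decrease, so the columns higher than \<open>i\<close> form an initial segment.\<close>

lemma parts_ge_conjugate:
  "k < parts_ge (Suc i) (conjugate L) \<longleftrightarrow> i < parts_ge (Suc k) L"
proof -
  let ?S = "{j. j < sum_mset L \<and> i < parts_ge (Suc j) L}"
  have aux: "(y \<noteq> 0 \<and> Suc i \<le> y) = (Suc i \<le> y)" for y :: nat by auto
  have "parts_ge (Suc i) (conjugate L) =
      size {#j \<in># mset_set {..<sum_mset L}. Suc i \<le> parts_ge (Suc j) L#}"
    unfolding conjugate_def filter_filter_mset filter_mset_image_mset size_image_mset aux ..
  also have "\<dots> = card ?S"
    by (simp add: filter_mset_mset_set Suc_le_eq)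
  finally have "k < parts_ge (Suc i) (conjugate L) \<longleftrightarrow> k < card ?S" by simp
  also have "\<dots> \<longleftrightarrow> k \<in> ?S"
  proof (rule less_card_down_closed)
    fix a b assume "b \<in> ?S" "a \<le> b"
    then show "a \<in> ?S" using parts_ge_antimono[of "Suc a" "Suc b" L] by auto
  qed simp
  also have "\<dots> \<longleftrightarrow> i < parts_ge (Suc k) L"
  proof -
    have "k < sum_mset L" if "0 < parts_ge (Suc k) L"
    proof -
      have "Suc k * 1 \<le> Suc k * parts_ge (Suc k) L" using that by (intro mult_le_mono2) simp
      then have "Suc k \<le> sum_mset L" using parts_ge_mult_le[of "Suc k" L] by (simp only: mult_1_right)
      then show ?thesis by simp
    qed
    then show ?thesis by auto
  qed
  finally show ?thesis .
qed

text \<open>The conjugate determines all column heights, and the multiplicity of a part is the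
  difference of two adjacent heights.\<close>

lemma inj_on_conjugate: "inj_on conjugate (partitions n)"
proof (rule inj_onI)
  fix L M assume L: "L \<in> partitions n" and M: "M \<in> partitions n"
    and eq: "conjugate L = conjugate M"
  have "i < parts_ge (Suc k) L \<longleftrightarrow> i < parts_ge (Suc k) M" for i k
    using parts_ge_conjugate[of k i L] parts_ge_conjugate[of k i M] eq by simp
  then have ge: "parts_ge (Suc k) L = parts_ge (Suc k) M" for k
    by (metis nat_neq_iff)
  show "L = M"
  proof (rule multiset_eqI)
    fix x
    show "count L x = count M x"
    proof (cases x)
      case 0
      then show ?thesis using L M by (simp add: partitions_def not_in_iff)
    next
      case (Suc k)
      then show ?thesis
        using parts_ge_Suc[of x L] parts_ge_Suc[of x M] ge[of k] ge[of x] by simp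
    qed
  qed
qed

text \<open>Conjugation transposes the rectangle and is injective. Using this in both directions
  gives equality without computing the conjugate of a conjugate.\<close>

lemma rect_count_le_transposed:
  "rect_count (Suc a) (Suc b) k \<le> rect_count (Suc b) (Suc a) k"
proof (cases "k < 0")
  case False
  have "card {L \<in> partitions (nat k). Suc a \<le> parts_ge (Suc b) L} \<le>
      card {L \<in> partitions (nat k). Suc b \<le> parts_ge (Suc a) L}"
  proof (rule card_inj_on_le[where f = conjugate])
    show "inj_on conjugate {L \<in> partitions (nat k). Suc a \<le> parts_ge (Suc b) L}"
      by (rule inj_on_subset[OF inj_on_conjugate]) auto
    show "conjugate ` {L \<in> partitions (nat k). Suc a \<le> parts_ge (Suc b) L} \<subseteq>
        {L \<in> partitions (nat k). Suc b \<le> parts_ge (Suc a) L}"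
    proof (intro image_subsetI)
      fix L assume L: "L \<in> {L \<in> partitions (nat k). Suc a \<le> parts_ge (Suc b) L}"
      then have "b < parts_ge (Suc a) (conjugate L)"
        by (simp only: parts_ge_conjugate mem_Collect_eq Suc_le_lessD)
      then show "conjugate L \<in> {L \<in> partitions (nat k). Suc b \<le> parts_ge (Suc a) L}"
        using L conjugate_in_partitions by (simp add: Suc_leI)
    qed
  qed simp
  then show ?thesis using False by (simp add: rect_count_def pcount_def)
qed (simp add: rect_count_def pcount_neg)

lemma rect_count_commute:
  assumes "1 \<le> a" "1 \<le> b"
  shows "rect_count a b k = rect_count b a k"
  using assms rect_count_le_transposed[of "a - 1" "b - 1" k]
    rect_count_le_transposed[of "b - 1" "a - 1" k] by simp

subsection \<open>The crank\<close>

lemma pcount_num_ones_ge: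
  assumes "\<And>L. Q (L + replicate_mset j 1) = Q L"
  shows "pcount (\<lambda>L. j \<le> num_ones L \<and> Q L) k = pcount Q (k - int j)"
proof -
  have "pcount (\<lambda>L. j \<le> num_ones L \<and> Q L) k
      = pcount Q (k - int (sum_mset (replicate_mset j (1::nat))))"
    by (rule pcount_shift)
      (use assms in \<open>auto simp: num_ones_def count_le_replicate_mset_subset_eq\<close>)
  then show ?thesis by simp
qed

text \<open>Exactly \<open>j\<close> ones means at least \<open>j\<close> but not at least
  \<open>j + 1\<close>; as \<open>Q\<close> ignores ones, each of these counts is a shift of the
  count of \<open>Q\<close>.\<close>

lemma pcount_num_ones_eq:
  assumes "\<And>i L. Q (L + replicate_mset i 1) = Q L"
  shows "pcount (\<lambda>L. num_ones L = j \<and> Q L) k = pcount Q (k - int j) - pcount Q (k - int j - 1)"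
proof -
  have "pcount (\<lambda>L. j \<le> num_ones L \<and> Q L) k - pcount (\<lambda>L. Suc j \<le> num_ones L \<and> Q L) k
      = pcount (\<lambda>L. (j \<le> num_ones L \<and> Q L) \<and> \<not> (Suc j \<le> num_ones L \<and> Q L)) k"
    by (rule pcount_diff) auto
  also have "\<dots> = pcount (\<lambda>L. num_ones L = j \<and> Q L) k" by (rule pcount_cong) auto
  finally show ?thesis
    using pcount_num_ones_ge[of Q, OF assms, of j k] pcount_num_ones_ge[of Q, OF assms, of "Suc j" k]
    by (simp add: algebra_simps)
qed

lemma rect_count_num_ones:
  assumes "2 \<le> b"
  shows "pcount (\<lambda>L. num_ones L = j \<and> a \<le> parts_ge b L) k =
    rect_count a b (k - int j) - rect_count a b (k - int j - 1)"
  unfolding rect_count_def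
proof (rule pcount_num_ones_eq)
  fix i and L :: "nat multiset"
  have "{#x \<in># replicate_mset i 1. b \<le> x#} = {#}" using assms by (induction i) auto
  then show "(a \<le> parts_ge b (L + replicate_mset i 1)) = (a \<le> parts_ge b L)"
    unfolding filter_union_mset by (metis add.right_neutral)
qed

text \<open>The summand for \<open>j\<close> is the share of the partitions with \<open>j\<close>
  ones in the count of cranks at least \<open>m\<close>, see \<open>pcount_crank_ge\<close>. The
  argument \<open>k\<close> is kept free for the recursion in \<open>m\<close>.\<close>

definition rect_sum :: "nat \<Rightarrow> nat \<Rightarrow> int \<Rightarrow> int" where
  "rect_sum K m k =
    (\<Sum>j<K. rect_count (j + 1) (j + m) (k - int j) - rect_count (j + 1) (j + m) (k - int j - 1))"

text \<open>The sum \<open>D\<close> telescopes in two ways, by \<open>rect_count_rec\<close> and by its transpose.\<close>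

lemma rect_sum_rec:
  assumes "1 \<le> m" "k < int K"
  shows "rect_sum K m k = npart (k - int m) - rect_sum K (m + 1) (k - int m)"
proof -
  define D where
    "D N = (\<Sum>i<N. rect_count (i + 1) (i + m) k - rect_count (i + 1) (i + m + 1) k)" for N
  \<comment> \<open>Removing row \<open>N + 1\<close> of length \<open>N + m\<close> turns each
    summand of \<open>D\<close> into a telescoping difference minus a summand of
    \<open>rect_sum\<close> for \<open>m + 1\<close>.\<close>
  have 1: "D N + rect_sum N (m + 1) (k - int m) =
      npart (k - int m) - rect_count N (N + m) (k - int m - int N)" for N
  proof (induction N)
    case 0
    then show ?case by (simp add: D_def rect_sum_def rect_count_0)
  next
    case (Suc N)
    show ?case
      using Suc assms rect_count_rec[of "N + m" N k]
      by (simp add: D_def rect_sum_def algebra_simps)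
  qed
  \<comment> \<open>The transposed recursion, removing a column instead of a row, turns the same sum
    into \<open>rect_sum\<close> for \<open>m\<close>.\<close>
  have 2: "D N = rect_sum N m k + rect_count (N + 1) (N + m) (k - int N)
      - rect_count (N + 1) (N + m) k" for N
  proof (induction N)
    case 0
    then show ?case by (simp add: D_def rect_sum_def)
  next
    case (Suc N)
    have "rect_count (N + 1) (N + m + 1) k - rect_count (N + 2) (N + m + 1) k =
        rect_count (N + 1) (N + m) (k - int N - 1) - rect_count (N + 2) (N + m + 1) (k - int N - 1)"
      using rect_count_rec[of "N + 1" "N + m" k] assms(1)
        rect_count_commute[of "N + m + 1" "N + 1"] rect_count_commute[of "N + m + 1" "N + 2"]
        rect_count_commute[of "N + m" "N + 1"]
      by (simp add: algebra_simps)
    then show ?case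
      using Suc by (simp add: D_def rect_sum_def algebra_simps)
  qed
  \<comment> \<open>All boundary terms vanish: their rectangles have at least \<open>K\<close> rows,
    more than the size of the partition.\<close>
  have "rect_count K (K + m) (k - int m - int K) = 0"
    "rect_count (K + 1) (K + m) (k - int K) = 0" "rect_count (K + 1) (K + m) k = 0"
    using assms by (auto intro!: rect_count_eq_0)
  then show ?thesis using 1[of K] 2[of K] by simp
qed

section \<open>Alternating sums over runs of consecutive integers\<close>

definition stair :: "nat \<Rightarrow> nat \<Rightarrow> nat" where
  "stair s i = \<Sum>{s..<s + i}"

lemma stair_closed_form: "2 * int (stair s i) = int i * (2 * int s + int i - 1)"
  by (induction i) (simp_all add: stair_def algebra_simps)

text \<open>Iterates \<open>rect_sum_rec\<close>. Each step lowers \<open>k\<close> by at least 1,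
  so after \<open>N\<close> steps the argument is negative and the remainder vanishes; the value
  therefore does not depend on \<open>K\<close>.\<close>

lemma rect_sum_eq:
  assumes "1 \<le> m" "k < int K" "k < int N"
  shows "rect_sum K m k = (\<Sum>i<N. (- 1) ^ i * npart (k - int (stair m (i + 1))))"
  using assms
proof (induction N arbitrary: m k)
  case 0
  then show ?case by (simp add: rect_sum_def rect_count_eq_0)
next
  case (Suc N)
  have stair: "stair m (i + 2) = m + stair (m + 1) (i + 1)" for i
    using stair_closed_form[of m "i + 2"] stair_closed_form[of "m + 1" "i + 1"]
    by (simp add: algebra_simps)
  have "rect_sum K m k = npart (k - int m) - rect_sum K (m + 1) (k - int m)"
    using Suc.prems by (intro rect_sum_rec) auto
  also have "rect_sum K (m + 1) (k - int m) =
      (\<Sum>i<N. (- 1) ^ i * npart (k - int m - int (stair (m + 1) (i + 1))))"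
    using Suc.prems by (intro Suc.IH) auto
  also have "\<dots> = - (\<Sum>i<N. (- 1) ^ Suc i * npart (k - int (stair m (Suc i + 1))))"
    using stair by (simp add: sum_negf algebra_simps)
  moreover have "stair m 1 = m" by (simp add: stair_def)
  ultimately show ?case by (simp only: sum.lessThan_Suc_shift) simp
qed

lemma Max_mset_ge_iff:
  assumes "L \<noteq> {#}"
  shows "m \<le> Max_mset L \<longleftrightarrow> (\<exists>x\<in>#L. m \<le> x)"
  using assms by (simp add: Max_ge_iff)

lemma parts_ge_pos_iff: "1 \<le> parts_ge m L \<longleftrightarrow> (\<exists>x\<in>#L. m \<le> x)"
  by (induction L) auto

lemma num_ones_le: "L \<in> partitions n \<Longrightarrow> num_ones L < Suc n"
  using size_le_partition[of L n] count_le_size[of L 1] by (simp add: num_ones_def)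

lemma partition_nonempty: "L \<in> partitions n \<Longrightarrow> 0 < n \<Longrightarrow> L \<noteq> {#}"
  by (auto simp: partitions_def)

lemma num_above_ones_eq: "num_above_ones L = parts_ge (num_ones L + 1) L"
  by (simp add: num_above_ones_def Suc_le_eq)

text \<open>With \<open>j > 0\<close> ones, crank at least \<open>m\<close> means at least
  \<open>j + m\<close> parts exceeding \<open>j\<close>: a rectangle, which is then transposed.
  Without ones, the largest part gives a single row of length \<open>m\<close>.\<close>

lemma pcount_crank_ge:
  assumes "2 \<le> n" "1 \<le> m"
  shows "pcount (\<lambda>L. int m \<le> crank L) (int n) = rect_sum (n + 1) m (int n)"
proof -
  have "pcount (\<lambda>L. num_ones L = j \<and> int m \<le> crank L) (int n) =
      rect_count (j + 1) (j + m) (int n - int j) - rect_count (j + 1) (j + m) (int n - int j - 1)"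
    for j
  proof (cases "j = 0")
    case True
    have eq: "pcount (\<lambda>L. num_ones L = j \<and> int m \<le> crank L) (int n) =
        pcount (\<lambda>L. num_ones L = 0 \<and> 1 \<le> parts_ge m L) (int n)"
      unfolding True
    proof (rule pcount_cong)
      fix L assume "L \<in> partitions (nat (int n))"
      then have "L \<noteq> {#}" using assms partition_nonempty[of L n] by simp
      then have "m \<le> Max_mset L \<longleftrightarrow> 1 \<le> parts_ge m L"
        unfolding parts_ge_pos_iff by (rule Max_mset_ge_iff)
      then show "(num_ones L = 0 \<and> int m \<le> crank L) = (num_ones L = 0 \<and> 1 \<le> parts_ge m L)"
        by (simp add: crank_def)
    qed
    show ?thesis
    \<comment> \<open>A single cell may be supplied by a part 1, so
      \<open>rect_count_num_ones\<close> does not apply. Every nonempty partition contains that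
      cell, and \<open>2 \<le> n\<close> keeps \<open>n - 1\<close> positive.\<close>
    proof (cases "m = 1")
      case m: True
      have *: "1 \<le> parts_ge 1 L" if L: "L \<in> partitions k" "0 < k" for k L
      proof -
        obtain x where x: "x \<in># L" using partition_nonempty[OF L] by blast
        then have "1 \<le> x" using partitionsD(1)[OF L(1)] by (cases x) auto
        then show ?thesis using x parts_ge_pos_iff by blast
      qed
      have npart: "rect_count 1 1 k = npart k" if "1 \<le> k" for k
        unfolding rect_count_def
        by (rule pcount_cong) (use that *[of _ "nat k"] in auto)
      have "pcount (\<lambda>L. num_ones L = 0 \<and> 1 \<le> parts_ge 1 L) (int n)
          = pcount (\<lambda>L. num_ones L = 0 \<and> True) (int n)"
        by (rule pcount_cong) (use assms *[of _ n] in auto)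
      also have "\<dots> = npart (int n) - npart (int n - 1)"
        using pcount_num_ones_eq[of "\<lambda>_. True" 0 "int n"] by simp
      finally show ?thesis
        unfolding eq unfolding True m using npart[of "int n"] npart[of "int n - 1"] assms by simp
    next
      case False
      then show ?thesis using True eq rect_count_num_ones[of m 0 1 "int n"] assms by simp
    qed
  next
    case False
    have "pcount (\<lambda>L. num_ones L = j \<and> int m \<le> crank L) (int n) =
        pcount (\<lambda>L. num_ones L = j \<and> j + m \<le> parts_ge (j + 1) L) (int n)"
      using False by (intro pcount_cong) (auto simp: crank_def num_above_ones_eq)
    then show ?thesis
      using False assms rect_count_commute[of "j + 1" "j + m"]
        rect_count_num_ones[of "j + 1" j "j + m" "int n"] by simp
  qed
  then show ?thesis
    unfolding rect_sum_def using num_ones_le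
    by (subst pcount_fibres[where f = num_ones and K = "n + 1"]) (simp_all only: Suc_eq_plus1)
qed

section \<open>Symmetry of the crank\<close>

lemma pcount_crank_neg:
  assumes "2 \<le> n"
  shows "pcount (\<lambda>L. crank L < 0) (int n) = npart (int n - 1) - rect_sum n 2 (int n - 1)"
proof -
  let ?t = "\<lambda>j. npart (int n - 1 - int j)"
  have 0: "pcount (\<lambda>L. num_ones L = 0 \<and> crank L < 0) (int n) = 0"
    by (intro pcount_eq_0) (auto simp: crank_def)
  \<comment> \<open>With \<open>j + 1\<close> ones, negative crank means fewer than
    \<open>j + 1\<close> parts that are at least \<open>j + 2\<close>. The complement is the summand
    for \<open>j\<close> of \<open>rect_sum\<close> with \<open>m = 2\<close> at
    \<open>n - 1\<close>.\<close>
  have "pcount (\<lambda>L. num_ones L = Suc j \<and> crank L < 0) (int n) = ?t j - ?t (Suc j) -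
      (rect_count (j + 1) (j + 2) (int n - 1 - int j)
        - rect_count (j + 1) (j + 2) (int n - 1 - int j - 1))" for j
  proof -
    have "pcount (\<lambda>L. num_ones L = Suc j \<and> crank L < 0) (int n) =
        pcount (\<lambda>L. (num_ones L = Suc j \<and> True)
          \<and> \<not> (num_ones L = Suc j \<and> j + 1 \<le> parts_ge (j + 2) L)) (int n)"
      by (intro pcount_cong) (auto simp: crank_def num_above_ones_eq)
    also have "\<dots> = pcount (\<lambda>L. num_ones L = Suc j \<and> True) (int n)
        - pcount (\<lambda>L. num_ones L = Suc j \<and> j + 1 \<le> parts_ge (j + 2) L) (int n)"
      by (rule pcount_diff[symmetric]) auto
    also have "pcount (\<lambda>L. num_ones L = Suc j \<and> True) (int n) = ?t j - ?t (Suc j)"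
      by (subst pcount_num_ones_eq) (simp_all add: algebra_simps)
    also have "pcount (\<lambda>L. num_ones L = Suc j \<and> j + 1 \<le> parts_ge (j + 2) L) (int n) =
        rect_count (j + 1) (j + 2) (int n - 1 - int j)
          - rect_count (j + 1) (j + 2) (int n - 1 - int j - 1)"
      by (subst rect_count_num_ones) (simp_all add: algebra_simps)
    finally show ?thesis .
  qed
  then have "pcount (\<lambda>L. crank L < 0) (int n) =
      (\<Sum>j<n. ?t j - ?t (Suc j)) - rect_sum n 2 (int n - 1)"
    using pcount_fibres[of n num_ones "Suc n" "\<lambda>L. crank L < 0"] num_ones_le
    by (simp add: sum.lessThan_Suc_shift 0 rect_sum_def sum_subtractf del: sum.lessThan_Suc)
  also have "(\<Sum>j<n. ?t j - ?t (Suc j)) = npart (int n - 1)"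
    by (subst sum_lessThan_telescope') (simp add: pcount_neg)
  finally show ?thesis .
qed

text \<open>The recursion \<open>rect_sum_rec\<close> at \<open>m = 1\<close> says exactly this,
  once the cutoffs \<open>n\<close> and \<open>n + 1\<close> are reconciled.\<close>

lemma pcount_crank_neg_eq_pos:
  assumes "2 \<le> n"
  shows "pcount (\<lambda>L. crank L < 0) (int n) = pcount (\<lambda>L. 1 \<le> crank L) (int n)"
proof -
  have "rect_sum n 2 (int n - 1) = rect_sum (n + 1) 2 (int n - 1)"
    using rect_sum_eq[of 2 "int n - 1" n n] rect_sum_eq[of 2 "int n - 1" "n + 1" n] by simp
  then show ?thesis
    using pcount_crank_neg[OF assms] pcount_crank_ge[OF assms, of 1]
      rect_sum_rec[of 1 "int n" "n + 1"] by (simp only: one_add_one of_nat_1)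
qed

subsection \<open>The rank\<close>

text \<open>For nonempty \<open>L\<close> this is rank at least \<open>m\<close>. The existential
  makes it false for the empty partition, as Dyson's map requires when \<open>n = 0\<close>.\<close>

definition wide :: "nat \<Rightarrow> nat multiset \<Rightarrow> bool" where
  "wide m L \<longleftrightarrow> (\<exists>x\<in>#L. size L + m \<le> x)"

definition strip_column :: "nat multiset \<Rightarrow> nat multiset" where
  "strip_column L = {#x \<in># image_mset (\<lambda>x. x - 1) L. x \<noteq> 0#}"

lemma strip_column:
  assumes "0 \<notin># L"
  shows size_strip_column: "size (strip_column L) \<le> size L"
    and sum_strip_column: "sum_mset (strip_column L) + size L = sum_mset L"
    and add_column_strip_column:
      "image_mset Suc (strip_column L) + replicate_mset (size L - size (strip_column L)) 1 = L"
proof -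
  show le: "size (strip_column L) \<le> size L" for L
    unfolding strip_column_def by (metis size_filter_mset_lesseq size_image_mset)
  show "sum_mset (strip_column L) + size L = sum_mset L"
    using assms unfolding strip_column_def by (induction L) auto
  show "image_mset Suc (strip_column L) + replicate_mset (size L - size (strip_column L)) 1 = L"
    using assms
  proof (induction L)
    case empty
    then show ?case by (simp add: strip_column_def)
  next
    case (add x L)
    show ?case
    proof (cases "x = 1")
      case True
      then have "strip_column (add_mset x L) = strip_column L" by (simp add: strip_column_def)
      then show ?thesis using True add le[of L] by (simp add: Suc_diff_le)
    next
      case False
      then have "strip_column (add_mset x L) = add_mset (x - 1) (strip_column L)" "Suc (x - 1) = x"
        using add.prems by (auto simp: strip_column_def)
      then show ?thesis using add by simp
    qed
  qed
qed

lemma strip_column_add_column: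
  assumes "0 \<notin># R"
  shows "strip_column (image_mset Suc R + replicate_mset i 1) = R"
proof -
  have 1: "{#x \<in># image_mset (\<lambda>x. x - 1) (replicate_mset i 1). x \<noteq> (0::nat)#} = {#}"
    by simp
  have 2: "{#x \<in># image_mset (\<lambda>x. x - 1) (image_mset Suc R). x \<noteq> 0#} = R"
    using assms by (induction R) auto
  show ?thesis
    unfolding strip_column_def image_mset_union filter_union_mset 1 2 by (rule add_0_right)
qed

text \<open>Dyson's map: replace the first column, of height \<open>\<ell>\<close>, by a new first row of length
  \<open>\<ell> + m + 1\<close>.\<close>

lemma card_wide:
  "card {L \<in> partitions (n + m + 1). wide m L} = card {L \<in> partitions n. \<not> wide (m + 3) L}"
proof -
  define f where "f L = add_mset (size L + m + 1) (strip_column L)" for L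
  \<comment> \<open>The largest part minus \<open>m + 1\<close> is the height of the column to
    restore; where it overhangs the remaining rows, it creates ones.\<close>
  define g where "g L = image_mset Suc (L - {#Max_mset L#}) +
    replicate_mset (Max_mset L - (m + 1) - size (L - {#Max_mset L#})) 1" for L
  have "bij_betw f {L \<in> partitions n. \<not> wide (m + 3) L} {L \<in> partitions (n + m + 1). wide m L}"
  proof (rule bij_betw_byWitness[where f' = g])
    show "\<forall>L\<in>{L \<in> partitions n. \<not> wide (m + 3) L}. g (f L) = L"
    proof
      fix L assume L: "L \<in> {L \<in> partitions n. \<not> wide (m + 3) L}"
      \<comment> \<open>The new row is the largest exactly if no part of \<open>L\<close> exceeds
        \<open>size L + m + 2\<close>, whence the bound \<open>m + 3\<close>.\<close>
      have "x \<le> size L + m + 1" if "x \<in># strip_column L" for x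
      proof -
        obtain y where "y \<in># L" "x = y - 1" using \<open>x \<in># strip_column L\<close>
          by (auto simp: strip_column_def)
        then show ?thesis using L by (force simp: wide_def)
      qed
      then have "Max_mset (f L) = size L + m + 1"
        by (intro Max_eqI) (auto simp: f_def)
      moreover from this have "f L - {#Max_mset (f L)#} = strip_column L"
        by (simp add: f_def)
      ultimately show "g (f L) = L"
        using add_column_strip_column[of L] partitionsD(1)[of L n] L by (simp add: g_def)
    qed
    have g: "f (g L) = L \<and> g L \<in> partitions n \<and> \<not> wide (m + 3) (g L)"
      if L: "L \<in> partitions (n + m + 1)" "wide m L" for L
    proof -
      define x where "x = Max_mset L"
      define R where "R = L - {#x#}"
      have ne: "L \<noteq> {#}" using L(2) by (auto simp: wide_def)
      have x: "x \<in># L" using ne by (simp add: x_def)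
      have LR: "L = add_mset x R" using x by (simp add: R_def)
      have max: "y \<le> x" if "y \<in># L" for y using that by (simp add: x_def)
      have R0: "0 \<notin># R" using L(1) LR by (auto simp: partitions_def)
      have size: "size R + 1 + m \<le> x" using L(2) max LR by (force simp: wide_def)
      have gL: "g L = image_mset Suc R + replicate_mset (x - (m + 1) - size R) 1"
        by (simp add: g_def x_def R_def)
      have szg: "size (g L) = x - (m + 1)" using size by (simp add: gL)
      have "f (g L) = L"
        unfolding f_def szg unfolding gL strip_column_add_column[OF R0] using size LR by simp
      moreover have "sum_mset (image_mset Suc R) = sum_mset R + size R"
        by (induction R) auto
      then have "sum_mset (g L) = n"
        using size partitionsD(2)[OF L(1), unfolded LR] unfolding gL by simp
      then have "g L \<in> partitions n" by (auto simp: partitions_def gL)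
      moreover have "\<not> wide (m + 3) (g L)"
      proof
        assume "wide (m + 3) (g L)"
        then obtain y where y: "y \<in># g L" "x + 2 \<le> y" using size by (auto simp: wide_def szg)
        then obtain z where "z \<in># R" "y = Suc z" unfolding gL by (auto split: if_splits)
        then show False using y(2) max[of z] LR by simp
      qed
      ultimately show ?thesis by blast
    qed
    show "\<forall>L\<in>{L \<in> partitions (n + m + 1). wide m L}. f (g L) = L"
      "g ` {L \<in> partitions (n + m + 1). wide m L} \<subseteq> {L \<in> partitions n. \<not> wide (m + 3) L}"
      using g by auto
    show "f ` {L \<in> partitions n. \<not> wide (m + 3) L} \<subseteq> {L \<in> partitions (n + m + 1). wide m L}"
    proof (intro image_subsetI)
      fix L assume L: "L \<in> {L \<in> partitions n. \<not> wide (m + 3) L}"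
      then have 0: "0 \<notin># L" by (auto simp: partitions_def)
      have "0 \<notin># f L" by (simp add: f_def strip_column_def)
      then show "f L \<in> {L \<in> partitions (n + m + 1). wide m L}"
        using sum_strip_column[OF 0] size_strip_column[OF 0] L
        by (auto simp: f_def wide_def partitions_def)
    qed
  qed
  then show ?thesis by (simp add: bij_betw_same_card)
qed

lemma pcount_wide_rec:
  "pcount (wide m) k = npart (k - int (m + 1)) - pcount (wide (m + 3)) (k - int (m + 1))"
proof (cases "k < int (m + 1)")
  case True
  have "pcount (wide m) k = 0"
  proof (rule pcount_eq_0, rule notI)
    fix L assume L: "L \<in> partitions (nat k)" "0 \<le> k" "wide m L"
    then obtain x where x: "x \<in># L" "size L + m \<le> x" by (auto simp: wide_def)
    then have "1 \<le> size L" by (cases "size L") auto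
    then show False using member_le_partition[OF L(1) x(1)] x(2) True L(2) by linarith
  qed
  then show ?thesis using True by (simp add: pcount_neg)
next
  case False
  define n where "n = nat k - (m + 1)"
  have k: "k = int (n + m + 1)" "k - int (m + 1) = int n" using False by (auto simp: n_def)
  have "npart (int n) - pcount (wide (m + 3)) (int n) =
      pcount (\<lambda>L. True \<and> \<not> wide (m + 3) L) (int n)"
    by (rule pcount_diff) simp
  also have "\<dots> = pcount (wide m) k"
    unfolding k(1) pcount_int card_wide by simp
  finally show ?thesis unfolding k(2) by simp
qed

text \<open>Iterates \<open>pcount_wide_rec\<close>. The subtracted amounts
  \<open>(i + 1) * (m + 1) + 3 * i * (i + 1) / 2\<close> are written as sums of runs starting at
  \<open>m + i + 1\<close>, to match the crank's expansion.\<close>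

lemma pcount_wide_eq:
  assumes "k < int N"
  shows "pcount (wide m) k = (\<Sum>i<N. (- 1) ^ i * npart (k - int (stair (m + i + 1) (i + 1))))"
  using assms
proof (induction N arbitrary: m k)
  case 0
  then show ?case by (simp add: pcount_neg)
next
  case (Suc N)
  have stair: "stair (m + i + 2) (i + 2) = m + 1 + stair (m + 3 + i + 1) (i + 1)" for i
    using stair_closed_form[of "m + i + 2" "i + 2"] stair_closed_form[of "m + 3 + i + 1" "i + 1"]
    by (simp add: algebra_simps)
  have "pcount (wide m) k = npart (k - int (m + 1)) - pcount (wide (m + 3)) (k - int (m + 1))"
    by (rule pcount_wide_rec)
  also have "pcount (wide (m + 3)) (k - int (m + 1)) =
      (\<Sum>i<N. (- 1) ^ i * npart (k - int (m + 1) - int (stair (m + 3 + i + 1) (i + 1))))"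
    using Suc.prems by (intro Suc.IH) auto
  also have "\<dots> = - (\<Sum>i<N. (- 1) ^ Suc i * npart (k - int (stair (m + Suc i + 1) (Suc i + 1))))"
    using stair by (simp add: sum_negf algebra_simps)
  finally show ?case by (simp only: sum.lessThan_Suc_shift) (simp add: stair_def)
qed

subsection \<open>Runs of consecutive parts\<close>

definition run_length :: "nat \<Rightarrow> nat multiset \<Rightarrow> nat" where
  "run_length s L = (LEAST r. s + r \<notin># L)"

lemma le_run_length_iff: "i \<le> run_length s L \<longleftrightarrow> {s..<s + i} \<subseteq> set_mset L"
proof -
  have "\<exists>r. s + r \<notin># L"
  proof (rule ccontr)
    assume "\<nexists>r. s + r \<notin># L"
    then have "range ((+) s) \<subseteq> set_mset L" by auto
    then have "finite (range ((+) s))" using finite_subset by blast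
    then show False using finite_imageD[of "(+) s" UNIV] by simp
  qed
  then have out: "s + run_length s L \<notin># L"
    unfolding run_length_def by (rule LeastI_ex)
  have "s + r \<in># L" if "r < run_length s L" for r
    using not_less_Least that unfolding run_length_def by blast
  then have "t \<in># L" if "i \<le> run_length s L" "t \<in> {s..<s + i}" for t
    using that by (metis add_less_cancel_left atLeastLessThan_iff le_Suc_ex less_le_trans)
  then have "{s..<s + i} \<subseteq> set_mset L" if "i \<le> run_length s L"
    using that by blast
  moreover have "i \<le> run_length s L" if "{s..<s + i} \<subseteq> set_mset L"
  proof (rule ccontr)
    assume "\<not> i \<le> run_length s L"
    then have "s + run_length s L \<in> {s..<s + i}" by simp
    then show False using that out by blast
  qed
  ultimately show ?thesis by blast
qed

lemma run_length_eqI: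
  assumes "{s..<s + r} \<subseteq> set_mset L" "s + r \<notin># L"
  shows "run_length s L = r"
proof -
  have "\<not> Suc r \<le> run_length s L" using assms(2) unfolding le_run_length_iff
    by (metis add_less_cancel_left atLeastLessThan_iff le_add1 lessI subsetD)
  moreover have "r \<le> run_length s L" using assms(1) unfolding le_run_length_iff .
  ultimately show ?thesis by linarith
qed

text \<open>Removing one copy of each of \<open>s, ..., s + i - 1\<close> is reversible. This gives
  the shifted values of \<open>npart\<close> a combinatorial meaning.\<close>

lemma pcount_run_length_ge:
  assumes "1 \<le> s"
  shows "pcount (\<lambda>L. i \<le> run_length s L) k = npart (k - int (stair s i))"
proof -
  have "pcount (\<lambda>L. i \<le> run_length s L) k
      = npart (k - int (sum_mset (mset_set {s..<s + i})))"
    unfolding le_run_length_iff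
  proof (rule pcount_shift)
    fix L :: "nat multiset" assume "{s..<s + i} \<subseteq> set_mset L"
    then show "mset_set {s..<s + i} \<subseteq># L"
      by (intro mset_subset_eqI) (auto simp: count_mset_set' Suc_le_eq)
  qed (use assms in auto)
  then show ?thesis by (simp add: stair_def sum_unfold_sum_mset)
qed

definition long_run :: "nat \<Rightarrow> nat multiset \<Rightarrow> bool" where
  "long_run s L \<longleftrightarrow> s \<le> run_length s L \<and> even (run_length s L + s)"

lemma alternating_of_bool_sum:
  "r < N \<Longrightarrow> (\<Sum>i\<in>{s..<N}. (- 1) ^ (i + s) * of_bool (i \<le> r)) =
    (of_bool (s \<le> r \<and> even (r + s)) :: int)"
proof -
  assume "r < N"
  then have "(\<Sum>i\<in>{s..<N}. (- 1) ^ (i + s) * of_bool (i \<le> r)) = (\<Sum>i\<in>{s..r}. (- 1 :: int) ^ (i + s))"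
    by (intro sum.mono_neutral_cong_right) auto
  also have "\<dots> = of_bool (s \<le> r \<and> even (r + s))"
  proof (cases "s \<le> r")
    case True
    then show ?thesis by (induction r rule: dec_induct) auto
  qed simp
  finally show ?thesis .
qed

text \<open>For each partition the alternating sum stops at its run length and leaves 1 or 0 by
  parity. The cutoff exceeds every run length, since a run consists of distinct parts.\<close>

lemma pcount_long_run:
  "pcount (long_run s) (int n) =
    (\<Sum>i\<in>{s..<n + 2}. (- 1) ^ (i + s) * pcount (\<lambda>L. i \<le> run_length s L) (int n))"
proof -
  have lt: "run_length s L < n + 2" if L: "L \<in> partitions n" for L
  proof -
    have "{s..<s + run_length s L} \<subseteq> set_mset L" using le_run_length_iff by blast
    then have "card {s..<s + run_length s L} \<le> card (set_mset L)" by (intro card_mono) auto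
    also have "\<dots> \<le> size L" by (induction L) (auto simp: card_insert_if)
    also have "\<dots> \<le> n" using L by (rule size_le_partition)
    finally show ?thesis by simp
  qed
  have "pcount (long_run s) (int n) =
      (\<Sum>L\<in>partitions n. \<Sum>i\<in>{s..<n + 2}. (- 1) ^ (i + s) * of_bool (i \<le> run_length s L))"
    unfolding pcount_eq_sum long_run_def
    by (intro sum.cong refl alternating_of_bool_sum[symmetric] lt)
  also have "\<dots> = (\<Sum>i\<in>{s..<n + 2}. \<Sum>L\<in>partitions n. (- 1) ^ (i + s) * of_bool (i \<le> run_length s L))"
    by (rule sum.swap)
  finally show ?thesis by (simp only: pcount_eq_sum sum_distrib_left)
qed

lemma run_length_notin: "s + run_length s L \<notin># L"
proof
  assume "s + run_length s L \<in># L"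
  then have "{s..<s + Suc (run_length s L)} \<subseteq> set_mset L"
    using le_run_length_iff[of "run_length s L" s L] by (auto simp: less_Suc_eq)
  then show False using le_run_length_iff[of "Suc (run_length s L)" s L] by simp
qed

lemma sum_mset_filter_neq:
  "sum_mset {#x \<in># L. x \<noteq> (a::nat)#} + count L a * a = sum_mset L"
  by (induction L) auto

text \<open>If \<open>s\<close> is a part, the run starting at \<open>s + 1\<close> extends to \<open>s\<close> and \<open>L\<close> qualifies unchanged.
  Otherwise splitting every part \<open>2 * s\<close> into two parts \<open>s\<close> yields a run from \<open>s\<close> of length
  exactly \<open>s\<close>; the images of the two cases differ in whether \<open>2 * s\<close> is a part.\<close>

lemma pcount_long_run_antimono:
  assumes "1 \<le> s"
  shows "pcount (long_run (Suc s)) (int n) \<le> pcount (long_run s) (int n)"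
proof -
  define f where "f L = (if s \<in># L then L
    else {#x \<in># L. x \<noteq> 2 * s#} + replicate_mset (2 * count L (2 * s)) s)" for L
  \<comment> \<open>A run of length at least \<open>s + 1\<close> from \<open>s + 1\<close> covers
    everything up to \<open>2 * s + 1\<close>.\<close>
  have double: "2 * s \<in># L" "{Suc s..<2 * s} \<subseteq> set_mset L" if "long_run (Suc s) L" for L
  proof -
    have "{Suc s..<Suc s + Suc s} \<subseteq> set_mset L"
      using that le_run_length_iff unfolding long_run_def by blast
    then show "2 * s \<in># L" "{Suc s..<2 * s} \<subseteq> set_mset L"
      using assms by (auto simp: subset_iff)
  qed
  have f: "f L \<in> {L \<in> partitions n. long_run s L}"
    if L: "L \<in> partitions n" "long_run (Suc s) L" for L
  proof (cases "s \<in># L")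
    case True
    let ?r = "run_length (Suc s) L"
    have "{Suc s..<Suc s + ?r} \<subseteq> set_mset L" using le_run_length_iff by blast
    moreover have "{s..<s + Suc ?r} = insert s {Suc s..<Suc s + ?r}" by auto
    ultimately have "{s..<s + Suc ?r} \<subseteq> set_mset L" using True by simp
    then have "run_length s L = Suc ?r"
      using run_length_notin[of "Suc s" L] by (intro run_length_eqI) simp_all
    then show ?thesis using True L by (simp add: f_def long_run_def)
  next
    case False
    have fL: "f L = {#x \<in># L. x \<noteq> 2 * s#} + replicate_mset (2 * count L (2 * s)) s"
      using False by (simp add: f_def)
    obtain c where "count L (2 * s) = Suc c"
      using double(1)[OF L(2)] by (metis count_eq_zero_iff not0_implies_Suc)
    then have s: "s \<in># f L" by (simp add: fL)
    have "{s..<s + s} = insert s {Suc s..<2 * s}" using assms by auto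
    moreover have "{Suc s..<2 * s} \<subseteq> set_mset (f L)"
      using double(2)[OF L(2)] by (auto simp: fL subset_iff)
    ultimately have "{s..<s + s} \<subseteq> set_mset (f L)" using s by simp
    moreover have "s + s \<notin># f L" using assms by (simp add: fL)
    ultimately have "run_length s (f L) = s" by (rule run_length_eqI)
    then have "long_run s (f L)" by (simp add: long_run_def)
    moreover have "sum_mset (f L) = n"
      using sum_mset_filter_neq[of "2 * s" L] partitionsD(2)[OF L(1)]
      by (simp add: fL algebra_simps)
    moreover have "0 \<notin># f L"
      using assms partitionsD(1)[OF L(1)] by (simp add: fL)
    ultimately show ?thesis by (simp add: partitions_def)
  qed
  have "inj_on f {L \<in> partitions n. long_run (Suc s) L}"
  proof (rule inj_onI)
    fix L M
    assume L: "L \<in> {L \<in> partitions n. long_run (Suc s) L}"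
      and M: "M \<in> {L \<in> partitions n. long_run (Suc s) L}" and eq: "f L = f M"
    have "2 * s \<in># f L \<longleftrightarrow> s \<in># L" if "long_run (Suc s) L" for L
      using assms double(1)[OF that] by (simp add: f_def)
    then have same: "s \<in># L \<longleftrightarrow> s \<in># M" using L M eq by (metis mem_Collect_eq)
    show "L = M"
    proof (cases "s \<in># L")
      case True
      then show ?thesis using same eq by (simp add: f_def)
    next
      case False
      then have "s \<notin># M" using same by blast
      then have 0: "count L s = 0" "count M s = 0" using False by (simp_all only: not_in_iff)
      have fx: "count (f N) x = (if x = 2 * s then 0 else count N x) +
          (if x = s then 2 * count N (2 * s) else 0)" if "s \<notin># N" for N x
        unfolding f_def if_not_P[OF that] by simp
      \<comment> \<open>As \<open>s\<close> is absent from both, its multiplicity in the image is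
        twice that of \<open>2 * s\<close> in the preimage.\<close>
      note count = fx[OF \<open>s \<notin># L\<close>, unfolded eq fx[OF \<open>s \<notin># M\<close>]]
      show ?thesis
      proof (rule multiset_eqI)
        fix x
        show "count L x = count M x"
        proof (cases "x = s")
          case True
          then show ?thesis using 0 by (simp only:)
        next
          case False
          then show ?thesis using count[of x] count[of s] 0 assms by (cases "x = 2 * s") simp_all
        qed
      qed
    qed
  qed
  then have "card {L \<in> partitions n. long_run (Suc s) L} \<le> card {L \<in> partitions n. long_run s L}"
    by (rule card_inj_on_le) (use f in auto)
  then show ?thesis by (simp add: pcount_int)
qed

subsection \<open>The inequality\<close>

text \<open>The upper bound \<open>f 0\<close> is carried along because the induction subtracts the
  tail sum.\<close>

lemma alternating_sum_nonneg:
  fixes f :: "nat \<Rightarrow> int"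
  assumes "\<And>i. f (Suc i) \<le> f i" "\<And>i. 0 \<le> f i"
  shows "0 \<le> (\<Sum>i<N. (- 1) ^ i * f i) \<and> (\<Sum>i<N. (- 1) ^ i * f i) \<le> f 0"
  using assms
proof (induction N arbitrary: f)
  case (Suc N)
  have "(\<Sum>i<Suc N. (- 1) ^ i * f i) = f 0 - (\<Sum>i<N. (- 1) ^ i * f (Suc i))"
    by (simp only: sum.lessThan_Suc_shift) (simp add: sum_negf)
  moreover have "0 \<le> (\<Sum>i<N. (- 1) ^ i * f (Suc i)) \<and> (\<Sum>i<N. (- 1) ^ i * f (Suc i)) \<le> f (Suc 0)"
    by (rule Suc.IH) (rule Suc.prems)+
  ultimately show ?case using Suc.prems(1)[of 0] by linarith
qed simp

lemma sum_positive_values: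
  assumes "\<And>L. L \<in> partitions n \<Longrightarrow> c L \<le> int n"
  shows "(\<Sum>L | L \<in> partitions n \<and> c L > 0. c L) =
    (\<Sum>m=1..n. pcount (\<lambda>L. int m \<le> c L) (int n))"
proof -
  have "(\<Sum>m=1..n. of_bool (int m \<le> z)) = (if 0 < z then z else 0)" if "z \<le> int n" for z :: int
  proof -
    have "(\<Sum>m=1..n. of_bool (int m \<le> z)) = int (card ({1..n} \<inter> {m. int m \<le> z}))"
      by (simp add: sum_of_bool_eq)
    also have "{1..n} \<inter> {m. int m \<le> z} = {1..nat z}" using that by auto
    finally show ?thesis by simp
  qed
  then have "(\<Sum>L\<in>partitions n. \<Sum>m=1..n. of_bool (int m \<le> c L)) =
      (\<Sum>L\<in>partitions n. if 0 < c L then c L else 0)"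
    using assms by (intro sum.cong) auto
  then show ?thesis
    by (simp only: pcount_eq_sum sum.swap[where A = "{1..n}"] sum.inter_filter[OF finite_partitions])
qed

lemma pcount_rank_ge:
  assumes "0 < n"
  shows "pcount (\<lambda>L. int m \<le> rank L) (int n) = pcount (wide m) (int n)"
proof (rule pcount_cong)
  fix L assume "L \<in> partitions (nat (int n))"
  then have "L \<noteq> {#}" using partition_nonempty[of L n] assms by simp
  then have "size L + m \<le> Max_mset L \<longleftrightarrow> wide m L" unfolding wide_def by (rule Max_mset_ge_iff)
  then show "(int m \<le> rank L) = wide m L" by (auto simp: rank_def)
qed

lemma Max_mset_le_partition: "L \<in> partitions n \<Longrightarrow> 0 < n \<Longrightarrow> Max_mset L \<le> n"
  using partition_nonempty[of L n] member_le_partition[of L n "Max_mset L"] by simp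

lemma crank_le: "L \<in> partitions n \<Longrightarrow> 0 < n \<Longrightarrow> crank L \<le> int n"
  using Max_mset_le_partition[of L n] parts_ge_le[of L n "num_ones L + 1"]
  by (simp add: crank_def num_above_ones_eq)

lemma rank_le: "L \<in> partitions n \<Longrightarrow> 0 < n \<Longrightarrow> rank L \<le> int n"
  using Max_mset_le_partition[of L n] by (simp add: rank_def)

lemma sum_crank_le_sum_rank:
  assumes "2 \<le> n"
  shows "(\<Sum>m=2..n. pcount (\<lambda>L. int m \<le> crank L) (int n)) \<le>
    (\<Sum>m=1..n. pcount (\<lambda>L. int m \<le> rank L) (int n))"
proof -
  define b where "b s i = npart (int n - int (stair s (i + 1)))" for s i
  have sign: "(- 1) ^ s * ((- 1) ^ (i + s) * z) = (- 1) ^ i * z" for s i and z :: int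
    by (cases "even s") (simp_all add: power_add)
  have b0: "b s i = 0" if "n < s" for s i
  proof -
    have "s \<le> stair s (i + 1)" unfolding stair_def by (rule member_le_sum) auto
    then show ?thesis using that by (simp add: b_def pcount_neg)
  qed
  have "(\<Sum>m=2..n. pcount (\<lambda>L. int m \<le> crank L) (int n)) =
      (\<Sum>m=2..n. \<Sum>i<n + 1. (- 1) ^ i * b m i)"
  proof (rule sum.cong)
    fix m assume "m \<in> {2..n}"
    then show "pcount (\<lambda>L. int m \<le> crank L) (int n) = (\<Sum>i<n + 1. (- 1) ^ i * b m i)"
      using pcount_crank_ge[OF assms, of m] rect_sum_eq[of m "int n" "n + 1" "n + 1"]
      unfolding b_def by simp
  qed simp
  then have C: "(\<Sum>m=2..n. pcount (\<lambda>L. int m \<le> crank L) (int n)) =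
      (\<Sum>i<n + 1. (- 1) ^ i * (\<Sum>s=2..n. b s i))"
    by (simp only: sum_distrib_left sum.swap[where A = "{2..n}"])
  \<comment> \<open>Substitute \<open>s = m + i + 1\<close>; terms with \<open>s > n\<close> vanish.
    The rank sum thus has the crank's terms, restricted to \<open>s \<ge> i + 2\<close>.\<close>
  have shift: "(\<Sum>m=1..n. b (m + i + 1) i) = (\<Sum>s=i + 2..n. b s i)" for i
  proof -
    have "(\<Sum>m=1..n. b (m + i + 1) i) = (\<Sum>s=1 + (i + 1)..n + (i + 1). b s i)"
      unfolding sum.shift_bounds_cl_nat_ivl by (simp only: add.assoc)
    also have "\<dots> = (\<Sum>s=i + 2..n. b s i)"
      by (rule sum.mono_neutral_right) (auto intro: b0)
    finally show ?thesis .
  qed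
  have "(\<Sum>m=1..n. pcount (\<lambda>L. int m \<le> rank L) (int n)) =
      (\<Sum>m=1..n. \<Sum>i<n + 1. (- 1) ^ i * b (m + i + 1) i)"
    using assms pcount_wide_eq[of "int n" "n + 1"] unfolding b_def
    by (intro sum.cong) (simp_all add: pcount_rank_ge)
  then have R: "(\<Sum>m=1..n. pcount (\<lambda>L. int m \<le> rank L) (int n)) =
      (\<Sum>i<n + 1. (- 1) ^ i * (\<Sum>s=i + 2..n. b s i))"
    by (simp only: sum_distrib_left sum.swap[where A = "{1..n}"] flip: shift)
  have "(\<Sum>s=2..n. b s i) = (\<Sum>s=i + 2..n. b s i) + (\<Sum>s=2..n. of_bool (s \<le> i + 1) * b s i)" for i
  proof -
    have "(\<Sum>s=2..n. b s i) = (\<Sum>s=2..n. of_bool (i + 2 \<le> s) * b s i) +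
        (\<Sum>s=2..n. of_bool (s \<le> i + 1) * b s i)"
      unfolding sum.distrib[symmetric] by (intro sum.cong) auto
    also have "(\<Sum>s=2..n. of_bool (i + 2 \<le> s) * b s i) = (\<Sum>s=i + 2..n. b s i)"
      by (intro sum.mono_neutral_cong_right) auto
    finally show ?thesis .
  qed
  then have "(\<Sum>m=2..n. pcount (\<lambda>L. int m \<le> crank L) (int n)) -
      (\<Sum>m=1..n. pcount (\<lambda>L. int m \<le> rank L) (int n)) =
      (\<Sum>i<n + 1. \<Sum>s=2..n. (- 1) ^ i * (of_bool (s \<le> i + 1) * b s i))"
    unfolding C R by (simp only: distrib_left sum.distrib sum_distrib_left)
  also have "\<dots> = (\<Sum>s=2..n. \<Sum>i<n + 1. (- 1) ^ i * (of_bool (s \<le> i + 1) * b s i))"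
    by (rule sum.swap)
  \<comment> \<open>What survives is \<open>s \<le> i + 1\<close>: runs from \<open>s\<close> of
    length \<open>i + 1\<close> at least \<open>s\<close>. The outer minus comes from passing from
    \<open>i\<close> to the length \<open>i + 1\<close>.\<close>
  also have "\<dots> = (\<Sum>s=2..n. - ((- 1) ^ s * pcount (long_run s) (int n)))"
  proof (rule sum.cong)
    fix s assume s: "s \<in> {2..n}"
    have "(- 1) ^ s * pcount (long_run s) (int n) =
        (\<Sum>i\<in>{s..<n + 2}. (- 1) ^ i * npart (int n - int (stair s i)))"
      unfolding pcount_long_run sum_distrib_left sign using s
      by (intro sum.cong refl) (subst pcount_run_length_ge, simp_all)
    also have "\<dots> = (\<Sum>i\<in>{1..<n + 2}. (- 1) ^ i * (of_bool (s \<le> i) * npart (int n - int (stair s i))))"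
      using s by (intro sum.mono_neutral_cong_left) auto
    also have "\<dots> = (\<Sum>i<n + 1. - ((- 1) ^ i * (of_bool (s \<le> i + 1) * b s i)))"
      by (rule sum.reindex_bij_witness[where i = Suc and j = "\<lambda>i. i - 1"])
        (auto simp: b_def Suc_le_eq gr0_conv_Suc)
    finally show "(\<Sum>i<n + 1. (- 1) ^ i * (of_bool (s \<le> i + 1) * b s i)) =
        - ((- 1) ^ s * pcount (long_run s) (int n))"
      by (simp add: sum_negf)
  qed simp
  also have "\<dots> = - (\<Sum>i<n - 1. (- 1) ^ i * pcount (long_run (i + 2)) (int n))"
    unfolding sum_negf[symmetric]
    by (rule sum.reindex_bij_witness[where i = "\<lambda>i. i + 2" and j = "\<lambda>i. i - 2"])
      (auto dest: le_Suc_ex[of 2])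
  also have "\<dots> \<le> 0"
    using alternating_sum_nonneg[of "\<lambda>i. pcount (long_run (i + 2)) (int n)" "n - 1"]
      pcount_long_run_antimono pcount_nonneg by simp
  finally show ?thesis by simp
qed

lemma ospt_le:
  assumes "2 \<le> n"
  shows "2 * ospt n \<le> int (num_partitions n) - int (crank_count 0 n)"
proof -
  let ?C = "\<lambda>m. pcount (\<lambda>L. int m \<le> crank L) (int n)"
  have "ospt n = (\<Sum>m=1..n. ?C m) - (\<Sum>m=1..n. pcount (\<lambda>L. int m \<le> rank L) (int n))"
    unfolding ospt_def using assms crank_le[of _ n] rank_le[of _ n] by (simp only: sum_positive_values)
  also have "(\<Sum>m=1..n. ?C m) = ?C 1 + (\<Sum>m=2..n. ?C m)"
    using assms by (subst sum.atLeast_Suc_atMost) (simp_all add: numeral_2_eq_2)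
  finally have le: "ospt n \<le> ?C 1" using sum_crank_le_sum_rank[OF assms] by linarith
  have "npart (int n) = pcount (\<lambda>L. crank L = 0) (int n) + pcount (\<lambda>L. \<not> crank L = 0) (int n)"
    using pcount_split[of "\<lambda>_. True" "int n" "\<lambda>L. crank L = 0"] by simp
  also have "pcount (\<lambda>L. \<not> crank L = 0) (int n) = pcount (\<lambda>L. crank L < 0) (int n) + ?C 1"
  proof -
    have "pcount (\<lambda>L. crank L \<noteq> 0 \<and> crank L < 0) (int n) = pcount (\<lambda>L. crank L < 0) (int n)"
      "pcount (\<lambda>L. crank L \<noteq> 0 \<and> \<not> crank L < 0) (int n) = ?C 1"
      by (auto intro!: pcount_cong)
    then show ?thesis
      using pcount_split[of "\<lambda>L. crank L \<noteq> 0" "int n" "\<lambda>L. crank L < 0"] by simp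
  qed
  also have "pcount (\<lambda>L. crank L < 0) (int n) = ?C 1"
    using pcount_crank_neg_eq_pos[OF assms] by simp
  finally show ?thesis
    using le by (simp add: pcount_int num_partitions_def crank_count_def)
qed

lemma crank_count_0_pos:
  assumes "3 \<le> n"
  shows "0 < crank_count 0 n"
proof -
  \<comment> \<open>One part is 1 and, as \<open>n - 1 \<ge> 2\<close>, exactly one part exceeds
    1.\<close>
  have "{#n - 1, 1#} \<in> {L \<in> partitions n. crank L = 0}"
    using assms by (auto simp: partitions_def crank_def num_ones_def num_above_ones_def)
  then have "{L \<in> partitions n. crank L = 0} \<noteq> {}" by blast
  then show ?thesis by (simp only: crank_count_def card_gt_0_iff) simp
qed

theorem theorem1p3:
  shows "(\<forall>n\<ge>2. real_of_int (ospt n) \<le> (real (num_partitions n) - real (crank_count 0 n)) / 2)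
       \<and> (\<forall>n\<ge>3. crank_count 0 n > 0)"
proof -
  have "real_of_int (ospt n) \<le> (real (num_partitions n) - real (crank_count 0 n)) / 2"
    if "2 \<le> n" for n
  proof -
    have "real_of_int (2 * ospt n) \<le> real_of_int (int (num_partitions n) - int (crank_count 0 n))"
      using ospt_le[OF that] by (simp only: of_int_le_iff)
    then show ?thesis by simp
  qed
  then show ?thesis using crank_count_0_pos by simp
qed

end
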